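(* Let $p\ge 1$, let $H\in\mathbb{R}^{p\times p}$ be symmetric positive semidefinite with $H_{ii}=1$ for all $i$, let $a\in\mathbb{R}^p$, $r_i>0$ for $i=1,\dots,p$, and let $f(x)=\tfrac12 x^\top Hx-a^\top x$ on the box $\mathcal{B}=\prod_{i=1}^p[0,r_i]$, with $X_*$, $\Delta$, $R$, $T$, $\chi_*$ as defined in the context. (1) Let $\kappa>0$ be any global residual error-bound constant, i.e. $\operatorname{dist}(x,X_* )\le\kappa\|R(x)\|$ for all $x\in\mathcal{B}$. Then $$\chi_*\le\frac{2\kappa\|T\|^2}{1+2\kappa\|T\|^2}.$$ (2) Let $\nu>0$ be any quadratic-growth constant, i.e. $\Delta(x)\ge\frac{\nu}{2}\operatorname{dist}(x,X_* )^2$ for all $x\in\mathcal{B}$. Then $$\kappa_\nu:=1+\frac{2\|I-H\|}{\nu+\lambda_{\min}(H)}$$ is a global residual error-bound constant, i.e. $\operatorname{dist}(x,X_* )\le\kappa_\nu\|R(x)\|$ for all $x\in\mathcal{B}$. In particular, the bound in (1) holds with $\kappa=\kappa_\nu$.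
   Context: $\|\cdot\|$ is the Euclidean norm on vectors and the induced (spectral) norm on matrices; $\lambda_{\min}$ is the smallest eigenvalue of a symmetric matrix; $\operatorname{dist}(x,P)=\min_{z\in P}\|x-z\|$. $X_*=\arg\min_{x\in\mathcal{B}}f(x)$ (nonempty, compact, convex), $f_*=\min_{x\in\mathcal{B}}f(x)$, $\Delta(x)=f(x)-f_*$, and $g(x)=Hx-a$ is the gradient of $f$. The unit-step projected-gradient residual is $R(x)=x-\Pi_{\mathcal{B}}(x-g(x))$, where $\Pi_{\mathcal{B}}$ is the Euclidean projection onto $\mathcal{B}$. Cyclic sweep: given $x\in\mathcal{B}$, put $x^0=x$; for $i=1,\dots,p$, $x^i$ agrees with $x^{i-1}$ except in coordinate $i$, where $x^i_i=\min\{r_i,\max\{0,\,x^{i-1}_i-g_i(x^{i-1})\}\}$ (the exact minimizer of $f$ in coordinate $i$ over $[0,r_i]$, since $H_{ii}=1$). Then $\mathcal{C}(x):=x^p$. The worst-case one-sweep objective contraction is $$\chi_*:=\sup_{x\in\mathcal{B}\setminus X_*}\frac{\Delta(\mathcal{C}(x))}{\Delta(x)}.$$ $T$ is the strictly lower triangular part of $H$: $T_{ij}=H_{ij}$ for $i>j$ and $T_{ij}=0$ for $i\le j$, so $H=I+T+T^\top$. *)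

theory Defs
  imports "HOL-Analysis.Analysis"
begin

type_synonym 'n rvec = "(real, 'n) vec"
type_synonym 'n rmat = "((real, 'n) vec, 'n) vec"

definition pos_semidef :: "('n::finite) rmat \<Rightarrow> bool" where
  "pos_semidef A \<longleftrightarrow> (\<forall>x. 0 \<le> x \<bullet> (A *v x))"

definition eigenvalue :: "('n::finite) rmat \<Rightarrow> real \<Rightarrow> bool" where
  "eigenvalue A l \<longleftrightarrow> (\<exists>v. v \<noteq> 0 \<and> A *v v = l *s v)"

text \<open>Used for symmetric matrices only, where a smallest real eigenvalue exists.\<close>
definition lambda_min :: "('n::finite) rmat \<Rightarrow> real" where
  "lambda_min A = (LEAST l. eigenvalue A l)"

definition spectral_norm :: "('n::finite) rmat \<Rightarrow> real" where
  "spectral_norm A = onorm ((*v) A)"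

definition quad_obj :: "('n::finite) rmat \<Rightarrow> 'n rvec \<Rightarrow> 'n rvec \<Rightarrow> real" where
  "quad_obj H a x = 1/2 * (x \<bullet> (H *v x)) - a \<bullet> x"

definition quad_grad :: "('n::finite) rmat \<Rightarrow> 'n rvec \<Rightarrow> 'n rvec \<Rightarrow> 'n rvec" where
  "quad_grad H a x = H *v x - a"

text \<open>On \<open>real^'n\<close>, \<open>cbox\<close> is the product of the intervals \<open>[0, r$i]\<close>.\<close>
definition box_of :: "('n::finite) rvec \<Rightarrow> 'n rvec set" where
  "box_of r = cbox 0 r"

definition opt_set :: "('n::finite) rmat \<Rightarrow> 'n rvec \<Rightarrow> 'n rvec \<Rightarrow> 'n rvec set" where
  "opt_set H a r = {x. is_arg_min (quad_obj H a) (\<lambda>y. y \<in> box_of r) x}"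

text \<open>The infimum is attained: the objective is continuous and the box is compact and
  (for nonnegative \<open>r\<close>) nonempty.\<close>
definition opt_val :: "('n::finite) rmat \<Rightarrow> 'n rvec \<Rightarrow> 'n rvec \<Rightarrow> real" where
  "opt_val H a r = (INF x\<in>box_of r. quad_obj H a x)"

definition gap :: "('n::finite) rmat \<Rightarrow> 'n rvec \<Rightarrow> 'n rvec \<Rightarrow> 'n rvec \<Rightarrow> real" where
  "gap H a r x = quad_obj H a x - opt_val H a r"

definition residual :: "('n::finite) rmat \<Rightarrow> 'n rvec \<Rightarrow> 'n rvec \<Rightarrow> 'n rvec \<Rightarrow> 'n rvec" where
  "residual H a r x = x - closest_point (box_of r) (x - quad_grad H a x)"

definition coord_step ::
    "('n::finite) rmat \<Rightarrow> 'n rvec \<Rightarrow> 'n rvec \<Rightarrow> 'n \<Rightarrow> 'n rvec \<Rightarrow> 'n rvec" where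
  "coord_step H a r i x =
     (\<chi> j. if j = i then min (r $ i) (max 0 (x $ i - quad_grad H a x $ i)) else x $ j)"

text \<open>The linear order on the index type plays the role of \<open>1 < \<dots> < p\<close>;
  \<open>fold\<close> performs the step of the smallest index first.\<close>
definition sweep ::
    "('n::{finite,linorder}) rmat \<Rightarrow> 'n rvec \<Rightarrow> 'n rvec \<Rightarrow> 'n rvec \<Rightarrow> 'n rvec" where
  "sweep H a r = fold (coord_step H a r) (sorted_list_of_set UNIV)"

text \<open>For \<open>H\<close> symmetric positive semidefinite with unit diagonal and \<open>r\<close> positive,
  the index set is nonempty (the objective is not constant on the box) and the ratios lie
  in \<open>[0,1]\<close> (a sweep never increases the objective), so this is a genuine supremum.\<close>
definition chi_star ::
    "('n::{finite,linorder}) rmat \<Rightarrow> 'n rvec \<Rightarrow> 'n rvec \<Rightarrow> real" where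
  "chi_star H a r =
     (SUP x \<in> box_of r - opt_set H a r. gap H a r (sweep H a r x) / gap H a r x)"

definition strict_lower :: "('n::{finite,linorder}) rmat \<Rightarrow> 'n rmat" where
  "strict_lower H = (\<chi> i j. if j < i then H $ i $ j else 0)"

definition residual_error_bound ::
    "('n::finite) rmat \<Rightarrow> 'n rvec \<Rightarrow> 'n rvec \<Rightarrow> real \<Rightarrow> bool" where
  "residual_error_bound H a r \<kappa> \<longleftrightarrow> 0 < \<kappa> \<and>
     (\<forall>x\<in>box_of r. infdist x (opt_set H a r) \<le> \<kappa> * norm (residual H a r x))"

definition quadratic_growth ::
    "('n::finite) rmat \<Rightarrow> 'n rvec \<Rightarrow> 'n rvec \<Rightarrow> real \<Rightarrow> bool" where
  "quadratic_growth H a r \<nu> \<longleftrightarrow> 0 < \<nu> \<and>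
     (\<forall>x\<in>box_of r. gap H a r x \<ge> \<nu> / 2 * (infdist x (opt_set H a r))\<^sup>2)"

definition kappa_growth :: "('n::finite) rmat \<Rightarrow> real \<Rightarrow> real" where
  "kappa_growth H \<nu> = 1 + 2 * spectral_norm (mat 1 - H) / (\<nu> + lambda_min H)"

definition sweep_bound :: "('n::{finite,linorder}) rmat \<Rightarrow> real \<Rightarrow> real" where
  "sweep_bound H \<kappa> =
     2 * \<kappa> * (spectral_norm (strict_lower H))\<^sup>2
       / (1 + 2 * \<kappa> * (spectral_norm (strict_lower H))\<^sup>2)"

end

theory Submission
  imports Defs
begin

text \<open>
  With \<open>d = C(x) - x\<close>, the point \<open>y = C(x)\<close> satisfies the implicit equation
  \<open>y = \<Pi>(x - g(x) - T d) = \<Pi>(y - g(y) + T\<^sup>T d)\<close>, i.e. it solves a projected gradient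
  equation up to the perturbation \<open>T\<^sup>T d\<close>.  The associated variational inequality gives at once
  \<open>\<parallel>R(y)\<parallel> \<le> \<parallel>T\<parallel> \<parallel>d\<parallel>\<close>, the decrease \<open>f(x) - f(y) \<ge> \<parallel>d\<parallel>\<^sup>2 / 2\<close> and
  \<open>\<Delta>(y) \<le> \<parallel>T\<parallel> \<parallel>d\<parallel> dist(y, X\<^sub>*)\<close>, and the error bound combines these into the contraction.
  Similarly \<open>z = \<Pi>(x - g(x))\<close> is stationary up to the perturbation \<open>(I - H) R(x)\<close>, and
  quadratic growth together with the exact second-order expansion at \<open>z\<close> bounds
  \<open>dist(z, X\<^sub>*)\<close>.
\<close>

section \<open>Matrices and quadratic forms\<close>

lemma inner_matrix_vector_mult:
  fixes A :: "real^'n^'m"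
  shows "x \<bullet> (A *v y) = (transpose A *v x) \<bullet> y"
  by (simp add: dot_lmul_matrix)

lemma norm_matrix_vector_mult_le_spectral_norm:
  "norm (A *v x) \<le> spectral_norm A * norm x"
  unfolding spectral_norm_def by (rule onorm) (rule matrix_vector_mul_bounded_linear)

lemma spectral_norm_nonneg: "0 \<le> spectral_norm A"
  unfolding spectral_norm_def by (rule onorm_pos_le) (rule matrix_vector_mul_bounded_linear)

text \<open>With \<open>q = transpose A *v x\<close>, the identity |q|^2 = x . (A q) \<le> |x| |A|
  |q| gives the bound after cancelling |q|.\<close>

lemma norm_transpose_mult_le_spectral_norm:
  "norm (transpose A *v x) \<le> spectral_norm A * norm x"
proof -
  let ?q = "transpose A *v x"
  have "norm ?q * norm ?q = x \<bullet> (A *v ?q)"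
    unfolding inner_matrix_vector_mult[of x]
    by (simp only: power2_norm_eq_inner flip: power2_eq_square)
  also have "\<dots> \<le> norm x * norm (A *v ?q)"
    by (rule norm_cauchy_schwarz)
  also have "\<dots> \<le> norm x * (spectral_norm A * norm ?q)"
    by (intro mult_left_mono norm_matrix_vector_mult_le_spectral_norm norm_ge_zero)
  finally have "norm ?q * norm ?q \<le> spectral_norm A * norm x * norm ?q"
    by (simp add: mult_ac)
  then show ?thesis
    using mult_right_le_imp_le[of "norm ?q" "norm ?q" "spectral_norm A * norm x"]
      spectral_norm_nonneg[of A]
    by (cases "norm ?q = 0") auto
qed

section \<open>The smallest eigenvalue as minimal Rayleigh quotient\<close>

lemma linear_coeff_eq_zero:
  fixes b c :: real
  assumes "\<And>t. 0 \<le> 2 * t * b + t\<^sup>2 * c"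
  shows "b = 0"
proof -
  have c: "0 \<le> c"
    using assms[of 1] assms[of "-1"] by simp
  \<comment> \<open>Near the minimizer -b/c of the parabola; the denominator 1 + c also covers c =
    0.\<close>
  have "0 \<le> 2 * (- b / (1 + c)) * b + (- b / (1 + c))\<^sup>2 * c"
    by (rule assms)
  also have "\<dots> = - (b\<^sup>2 * (2 + c) / (1 + c)\<^sup>2)"
    using c by (simp add: divide_simps power2_eq_square) algebra
  finally have "b\<^sup>2 * (2 + c) \<le> 0"
    using c by (simp add: divide_le_0_iff)
  then have "b\<^sup>2 \<le> 0"
    using c by (simp add: mult_le_0_iff)
  then show ?thesis by simp
qed

text \<open>The form x . (A x) - m |x|^2 is nonnegative and vanishes at \<open>v\<close>, so its
  first variation 2 w . (A v - m v) is zero in every direction \<open>w\<close>, in particular for w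
  = A v - m v.\<close>

lemma min_rayleigh_eigenvector:
  fixes A :: "('n::finite) rmat"
  assumes sym: "transpose A = A"
    and min: "\<And>x. m * (norm x)\<^sup>2 \<le> x \<bullet> (A *v x)"
    and attained: "v \<bullet> (A *v v) = m * (norm v)\<^sup>2"
  shows "A *v v = m *s v"
proof -
  have "w \<bullet> (A *v v - m *s v) = 0" for w
  proof (rule linear_coeff_eq_zero)
    fix t :: real
    have sw: "v \<bullet> (A *v w) = w \<bullet> (A *v v)"
      unfolding inner_matrix_vector_mult[of v] sym by (rule inner_commute)
    have "0 \<le> (v + t *\<^sub>R w) \<bullet> (A *v (v + t *\<^sub>R w)) - m * (norm (v + t *\<^sub>R w))\<^sup>2"
      using min[of "v + t *\<^sub>R w"] by simp
    also have "\<dots> = 2 * t * (w \<bullet> (A *v v - m *s v)) + t\<^sup>2 * (w \<bullet> (A *v w) - m * (norm w)\<^sup>2)"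
      using attained sw unfolding power2_norm_eq_inner
      by (simp add: matrix_vector_right_distrib inner_add_left
          inner_add_right inner_diff_right matrix_vector_mult_scaleR scalar_mult_eq_scaleR
          inner_commute algebra_simps power2_eq_square[of t])
    finally show "0 \<le> 2 * t * (w \<bullet> (A *v v - m *s v)) + t\<^sup>2 * (w \<bullet> (A *v w) - m * (norm w)\<^sup>2)" .
  qed
  from this[of "A *v v - m *s v"] show ?thesis by simp
qed

text \<open>Compactness of the unit sphere yields a minimizer of the quadratic form. Its value is an
  eigenvalue, and the least one because every eigenvalue is the Rayleigh quotient of its
  eigenvector; hence the \<open>LEAST\<close> in \<open>lambda_min\<close> is well defined.\<close>

lemma lambda_min_is_min_rayleigh:
  fixes A :: "('n::finite) rmat"
  assumes sym: "transpose A = A"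
  shows "eigenvalue A (lambda_min A)"
    and "lambda_min A * (norm x)\<^sup>2 \<le> x \<bullet> (A *v x)"
proof -
  let ?q = "\<lambda>x. x \<bullet> (A *v x)"
  have "axis undefined 1 \<in> sphere (0 :: 'n rvec) 1"
    by simp
  moreover have "continuous_on (sphere 0 1) ?q"
    by (intro continuous_intros matrix_vector_mult_linear_continuous_on)
  ultimately obtain v where v: "norm v = 1" and vmin: "\<And>u. norm u = 1 \<Longrightarrow> ?q v \<le> ?q u"
    using continuous_attains_inf[of "sphere (0 :: 'n rvec) 1" ?q] by auto
  have rayleigh: "?q v * (norm x)\<^sup>2 \<le> ?q x" for x
  proof (cases "x = 0")
    case False
    have "?q v \<le> ?q (x /\<^sub>R norm x)"
      using False by (intro vmin) simp
    also have "\<dots> = ?q x / (norm x)\<^sup>2"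
      by (simp add: matrix_vector_mult_scaleR power2_eq_square field_simps)
    finally show ?thesis
      using False by (simp add: field_simps)
  qed simp
  have eig: "eigenvalue A (?q v)"
    unfolding eigenvalue_def
  proof (intro exI conjI)
    show "v \<noteq> 0"
      using v by auto
    show "A *v v = ?q v *s v"
      by (rule min_rayleigh_eigenvector[OF sym rayleigh]) (simp add: v)
  qed
  have "lambda_min A = ?q v"
    unfolding lambda_min_def
  proof (rule Least_equality[of "eigenvalue A", OF eig])
    fix l assume "eigenvalue A l"
    then obtain u where u: "u \<noteq> 0" "A *v u = l *s u"
      unfolding eigenvalue_def by auto
    then have "?q u = l * (norm u)\<^sup>2"
      by (simp add: scalar_mult_eq_scaleR power2_norm_eq_inner)
    with rayleigh[of u] u show "?q v \<le> l"
      by simp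
  qed
  with eig rayleigh show "eigenvalue A (lambda_min A)" "lambda_min A * (norm x)\<^sup>2 \<le> ?q x"
    by simp_all
qed

lemma lambda_min_nonneg:
  assumes "transpose A = A" "pos_semidef A"
  shows "0 \<le> lambda_min A"
proof -
  obtain v where v: "v \<noteq> 0" "A *v v = lambda_min A *s v"
    using lambda_min_is_min_rayleigh(1)[OF assms(1)] unfolding eigenvalue_def by auto
  have "0 \<le> v \<bullet> (A *v v)"
    using assms(2) unfolding pos_semidef_def by blast
  also have "\<dots> = lambda_min A * (norm v)\<^sup>2"
    using v by (simp add: scalar_mult_eq_scaleR power2_norm_eq_inner)
  finally show ?thesis
    using v by (simp add: zero_le_mult_iff)
qed

lemma unit_diagonal_splitting:
  fixes H :: "('n::{finite,linorder}) rmat"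
  assumes sym: "transpose H = H" and diag: "\<And>i. H $ i $ i = 1"
  shows "H = mat 1 + strict_lower H + transpose (strict_lower H)"
proof -
  have "H $ i $ j = H $ j $ i" for i j
    using sym by (metis transpose_def vec_lambda_beta)
  then show ?thesis
    using diag
    by (auto simp: vec_eq_iff mat_def strict_lower_def transpose_def not_less_iff_gr_or_eq)
qed

section \<open>The box-constrained quadratic program\<close>

lemma quad_obj_expand:
  assumes "transpose H = H"
  shows "quad_obj H a x =
    quad_obj H a y + quad_grad H a y \<bullet> (x - y) + 1/2 * ((x - y) \<bullet> (H *v (x - y)))"
proof -
  have "y \<bullet> (H *v x) = x \<bullet> (H *v y)"
    by (simp only: inner_matrix_vector_mult[of y] assms inner_commute)
  then show ?thesis
    unfolding quad_obj_def quad_grad_def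
    by (simp add: matrix_vector_mult_diff_distrib inner_diff_left inner_diff_right
        inner_commute field_simps)
qed

lemma quad_grad_diff: "quad_grad H a x - quad_grad H a y = H *v (x - y)"
  by (simp add: quad_grad_def matrix_vector_mult_diff_distrib)

lemma continuous_on_quad_obj: "continuous_on S (quad_obj H a)"
  unfolding quad_obj_def
  by (intro continuous_intros matrix_vector_mult_linear_continuous_on)

lemma mem_box_of: "x \<in> box_of r \<longleftrightarrow> (\<forall>i. 0 \<le> x $ i \<and> x $ i \<le> r $ i)"
  by (simp add: box_of_def mem_box_cart)

lemma
  shows compact_box_of: "compact (box_of r)"
    and closed_box_of: "closed (box_of r)"
    and convex_box_of: "convex (box_of r)"
  by (simp_all add: box_of_def closed_cbox)

text \<open>The point \<open>y\<close> is \<open>\<Pi>(y - g(y) + q)\<close>, expressed as a variational inequality.\<close>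

definition perturbed_stationary ::
    "('n::finite) rvec \<Rightarrow> 'n rmat \<Rightarrow> 'n rvec \<Rightarrow> 'n rvec \<Rightarrow> 'n rvec \<Rightarrow> bool" where
  "perturbed_stationary r H a q y \<longleftrightarrow>
     y \<in> box_of r \<and> (\<forall>z\<in>box_of r. q \<bullet> (z - y) \<le> quad_grad H a y \<bullet> (z - y))"

context
  fixes r :: "('n::finite) rvec"
  assumes r_pos: "\<And>i. 0 < r $ i"
begin

lemma box_of_nonempty: "box_of r \<noteq> {}"
  using r_pos mem_box_of[of 0 r] by (auto simp: less_imp_le)

section \<open>Minimizers of the objective on the box\<close>

lemma opt_val_le:
  assumes "x \<in> box_of r"
  shows "opt_val H a r \<le> quad_obj H a x"
  unfolding opt_val_def
  using assms compact_imp_bounded[OF compact_continuous_image[OF continuous_on_quad_obj compact_box_of]]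
  by (intro cINF_lower bounded_imp_bdd_below)

lemma ex_minimizer: "\<exists>x\<in>box_of r. quad_obj H a x = opt_val H a r"
proof -
  obtain x where "x \<in> box_of r" "\<And>y. y \<in> box_of r \<Longrightarrow> quad_obj H a x \<le> quad_obj H a y"
    using continuous_attains_inf[OF compact_box_of box_of_nonempty continuous_on_quad_obj] by blast
  then show ?thesis
    unfolding opt_val_def
    by (intro bexI[of _ x] cInf_eq_minimum[symmetric]) auto
qed

lemma opt_set_eq: "opt_set H a r = {x \<in> box_of r. quad_obj H a x = opt_val H a r}"
proof -
  obtain z where "z \<in> box_of r" "quad_obj H a z = opt_val H a r"
    using ex_minimizer by blast
  then show ?thesis
    using opt_val_le unfolding opt_set_def is_arg_min_linorder
    by (auto intro: order.antisym simp: order.trans) (metis order.antisym)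
qed

lemma opt_set_nonempty: "opt_set H a r \<noteq> {}"
  unfolding opt_set_eq using ex_minimizer by blast

lemma closed_opt_set: "closed (opt_set H a r)"
proof -
  have "opt_set H a r = box_of r \<inter> quad_obj H a -` {opt_val H a r}"
    unfolding opt_set_eq by auto
  then show ?thesis
    by (simp add: continuous_closed_preimage closed_box_of continuous_on_quad_obj)
qed

lemma nearest_minimizer:
  obtains w where "w \<in> box_of r" "quad_obj H a w = opt_val H a r"
    "infdist x (opt_set H a r) = norm (x - w)"
proof -
  obtain w where "w \<in> opt_set H a r" "infdist x (opt_set H a r) = dist x w"
    using infdist_attains_inf[OF closed_opt_set opt_set_nonempty] .
  then show ?thesis
    using that by (auto simp: opt_set_eq dist_norm)
qed

lemma gap_pos:
  assumes "x \<in> box_of r - opt_set H a r"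
  shows "0 < gap H a r x"
  using assms opt_val_le[of x H a] unfolding opt_set_eq gap_def by auto

text \<open>Ensures that the supremum in \<open>chi_star\<close> ranges over a nonempty set: the
  unit diagonal makes the objective a nonconstant parabola along each axis.\<close>

lemma box_not_subset_opt_set:
  assumes diag: "\<And>i. H $ i $ i = 1"
  shows "box_of r - opt_set H a r \<noteq> {}"
proof
  assume "box_of r - opt_set H a r = {}"
  then have const: "quad_obj H a x = opt_val H a r" if "x \<in> box_of r" for x
    using that unfolding opt_set_eq by blast
  fix i :: 'n
  have line: "quad_obj H a (axis i t) = t\<^sup>2 / 2 - t * a $ i" for t
  proof -
    have "(H *v axis i t) $ i = t"
      by (simp add: matrix_vector_mult_def axis_def if_distrib[of "\<lambda>u. _ * u"] diag cong: if_cong)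
    then show ?thesis
      by (simp add: quad_obj_def inner_axis inner_axis' power2_eq_square)
  qed
  have "axis i t \<in> box_of r" if "0 \<le> t" "t \<le> r $ i" for t
    using that r_pos by (auto simp: mem_box_of axis_def less_imp_le)
  then have eq: "t\<^sup>2 / 2 - t * a $ i = opt_val H a r" if "0 \<le> t" "t \<le> r $ i" for t
    using that const line by metis
  \<comment> \<open>The second difference of the parabola over 0, r_i/2, r_i equals r_i^2/4, but
    that of a constant is 0.\<close>
  have "(r $ i)\<^sup>2 = 0"
    using eq[of 0] eq[of "r $ i / 2"] eq[of "r $ i"] r_pos[of i]
    by (simp add: power2_eq_square)
  then show False
    using r_pos[of i] by simp
qed

section \<open>Residual and gap at a perturbed stationary point\<close>

text \<open>Test the inequality of the projection \<open>w\<close> at \<open>y\<close> and that of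
  \<open>y\<close> at \<open>w\<close>. In the sum the gradient terms cancel, leaving |y - w|^2
  \<le> q . (y - w).\<close>

lemma perturbed_stationary_norm_residual_le:
  assumes "perturbed_stationary r H a q y"
  shows "norm (residual H a r y) \<le> norm q"
proof -
  define w where "w = closest_point (box_of r) (y - quad_grad H a y)"
  let ?s = "y - w"
  have y: "y \<in> box_of r"
    using assms unfolding perturbed_stationary_def by simp
  have w: "w \<in> box_of r"
    unfolding w_def by (rule closest_point_in_set[OF closed_box_of box_of_nonempty])
  have "(y - quad_grad H a y - w) \<bullet> (y - w) \<le> 0"
    unfolding w_def by (rule closest_point_dot[OF convex_box_of closed_box_of y])
  moreover have "q \<bullet> (w - y) \<le> quad_grad H a y \<bullet> (w - y)"
    using assms w unfolding perturbed_stationary_def by blast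
  ultimately have "?s \<bullet> ?s \<le> q \<bullet> ?s"
    by (simp add: inner_diff_left inner_diff_right)
  also have "\<dots> \<le> norm q * norm ?s"
    by (rule norm_cauchy_schwarz)
  finally have "norm ?s * norm ?s \<le> norm q * norm ?s"
    by (simp add: power2_norm_eq_inner flip: power2_eq_square)
  then have "norm ?s \<le> norm q"
    by (cases "norm ?s = 0") auto
  then show ?thesis
    by (simp add: residual_def w_def)
qed

text \<open>Expand the objective at \<open>y\<close> towards the nearest minimizer: stationarity
  bounds the linear term, the smallest eigenvalue the quadratic one.\<close>

lemma perturbed_stationary_gap_le:
  assumes sym: "transpose H = H" and y: "perturbed_stationary r H a q y"
  shows "gap H a r y \<le> norm q * infdist y (opt_set H a r)
    - lambda_min H / 2 * (infdist y (opt_set H a r))\<^sup>2"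
proof -
  obtain w where w: "w \<in> box_of r" "quad_obj H a w = opt_val H a r"
    and D: "infdist y (opt_set H a r) = norm (y - w)"
    using nearest_minimizer .
  have "lambda_min H * (norm (w - y))\<^sup>2 \<le> (w - y) \<bullet> (H *v (w - y))"
    by (rule lambda_min_is_min_rayleigh(2)[OF sym])
  moreover have "- (norm q * norm (w - y)) \<le> q \<bullet> (w - y)"
    using Cauchy_Schwarz_ineq2[of q "w - y"] by linarith
  moreover have "q \<bullet> (w - y) \<le> quad_grad H a y \<bullet> (w - y)"
    using y w(1) unfolding perturbed_stationary_def by blast
  ultimately have "gap H a r y \<le> norm q * norm (w - y) - lambda_min H / 2 * (norm (w - y))\<^sup>2"
    using quad_obj_expand[OF sym, of a w y] w(2) unfolding gap_def by simp
  then show ?thesis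
    by (simp add: D norm_minus_commute)
qed

section \<open>From quadratic growth to the residual error bound\<close>

text \<open>Since g(x) = g(z) + H (x - z), the vector x - g(x) - z in the projection inequality
  equals (I - H)(x - z) - g(z).\<close>

lemma projected_gradient_perturbed_stationary:
  assumes x: "x \<in> box_of r"
  shows "perturbed_stationary r H a ((mat 1 - H) *v residual H a r x) (x - residual H a r x)"
proof -
  define z where "z = closest_point (box_of r) (x - quad_grad H a x)"
  have z: "z \<in> box_of r"
    unfolding z_def by (rule closest_point_in_set[OF closed_box_of box_of_nonempty])
  have R: "residual H a r x = x - z"
    by (simp add: residual_def z_def)
  have "((mat 1 - H) *v (x - z)) \<bullet> (w - z) \<le> quad_grad H a z \<bullet> (w - z)" if "w \<in> box_of r" for w
  proof -
    have "(x - quad_grad H a x - z) \<bullet> (w - z) \<le> 0"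
      unfolding z_def by (rule closest_point_dot[OF convex_box_of closed_box_of that])
    moreover have "(mat 1 - H) *v (x - z) - quad_grad H a z = x - quad_grad H a x - z"
      using quad_grad_diff[of H a x z] by (simp add: matrix_vector_mult_diff_rdistrib algebra_simps)
    ultimately show ?thesis
      by (metis diff_le_0_iff_le inner_diff_left)
  qed
  then show ?thesis
    using z by (simp add: perturbed_stationary_def R)
qed

lemma residual_error_bound_kappa_growth:
  assumes sym: "transpose H = H" and psd: "pos_semidef H"
    and growth: "quadratic_growth H a r \<nu>"
  shows "residual_error_bound H a r (kappa_growth H \<nu>)"
proof -
  let ?N = "spectral_norm (mat 1 - H)" and ?X = "opt_set H a r"
  have c: "0 < \<nu> + lambda_min H"
    using growth lambda_min_nonneg[OF sym psd] unfolding quadratic_growth_def by linarith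
  have "infdist x ?X \<le> kappa_growth H \<nu> * norm (residual H a r x)" if x: "x \<in> box_of r" for x
  proof -
    let ?R = "residual H a r x"
    define z where "z = x - ?R"
    let ?D = "infdist z ?X"
    have z: "perturbed_stationary r H a ((mat 1 - H) *v ?R) z"
      unfolding z_def by (rule projected_gradient_perturbed_stationary[OF x])
    have "\<nu> / 2 * ?D\<^sup>2 \<le> gap H a r z"
      using growth z unfolding quadratic_growth_def perturbed_stationary_def by blast
    also have "\<dots> \<le> norm ((mat 1 - H) *v ?R) * ?D - lambda_min H / 2 * ?D\<^sup>2"
      by (rule perturbed_stationary_gap_le[OF sym z])
    \<comment> \<open>Growth is used at the projected point \<open>z\<close>, not at
      \<open>x\<close>; its square term and the curvature term add up, which produces the
      denominator of \<open>kappa_growth\<close>.\<close>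
    finally have "(\<nu> + lambda_min H) * ?D * ?D \<le> 2 * norm ((mat 1 - H) *v ?R) * ?D"
      by (simp add: algebra_simps power2_eq_square)
    then have "(\<nu> + lambda_min H) * ?D \<le> 2 * norm ((mat 1 - H) *v ?R)"
      using infdist_nonneg[of z ?X] by (cases "?D = 0") auto
    also have "\<dots> \<le> 2 * (?N * norm ?R)"
      using norm_matrix_vector_mult_le_spectral_norm[of "mat 1 - H" ?R] by simp
    finally have "?D \<le> 2 * ?N / (\<nu> + lambda_min H) * norm ?R"
      using c by (simp add: field_simps)
    \<comment> \<open>Going from \<open>z\<close> back to \<open>x\<close> costs |x - z| = |R(x)|,
      the summand 1 in \<open>kappa_growth\<close>.\<close>
    moreover have "infdist x ?X \<le> ?D + norm ?R"
      using infdist_triangle[of x ?X z] by (simp add: z_def dist_norm)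
    ultimately show ?thesis
      by (simp add: kappa_growth_def algebra_simps)
  qed
  moreover have "0 < kappa_growth H \<nu>"
    using c spectral_norm_nonneg[of "mat 1 - H"]
    unfolding kappa_growth_def by (intro add_pos_nonneg) auto
  ultimately show ?thesis
    unfolding residual_error_bound_def by blast
qed

end

section \<open>The cyclic sweep\<close>

text \<open>When coordinate \<open>i\<close> is updated, exactly the listed coordinates below
  \<open>i\<close> have moved, and they already have their final values. So the sequential loop
  becomes an implicit equation in its result \<open>y\<close>.\<close>

lemma fold_coord_step_nth:
  fixes H :: "('n::{finite,linorder}) rmat" and a r x :: "'n rvec"
  assumes "sorted_wrt (<) xs"
  defines "y \<equiv> fold (coord_step H a r) xs x"
  shows "y $ i = (if i \<in> set xs
    then min (r $ i) (max 0 (x $ i - quad_grad H a x $ i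
           - (\<Sum>j\<in>{j\<in>set xs. j < i}. H $ i $ j * (y $ j - x $ j))))
    else x $ i)"
  using assms(1) unfolding y_def
proof (induction xs arbitrary: i rule: rev_induct)
  case Nil
  then show ?case by simp
next
  case (snoc k ks)
  define u where "u = fold (coord_step H a r) ks x"
  define v where "v = coord_step H a r k u"
  have lt: "\<And>j. j \<in> set ks \<Longrightarrow> j < k" and sorted: "sorted_wrt (<) ks"
    using snoc.prems by (auto simp: sorted_wrt_append)
  have IH: "u $ i = (if i \<in> set ks
    then min (r $ i) (max 0 (x $ i - quad_grad H a x $ i
           - (\<Sum>j\<in>{j\<in>set ks. j < i}. H $ i $ j * (u $ j - x $ j))))
    else x $ i)" for i
    unfolding u_def by (rule snoc.IH[OF sorted])
  have v_other: "v $ j = u $ j" if "j \<noteq> k" for j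
    using that by (simp add: v_def coord_step_def)
  \<comment> \<open>For i \<le> k the sum stops before \<open>k\<close>, the only coordinate changed
    by the last step.\<close>
  have sum_eq: "(\<Sum>j\<in>{j\<in>set (ks @ [k]). j < i}. H $ i $ j * (v $ j - x $ j)) =
      (\<Sum>j\<in>{j\<in>set ks. j < i}. H $ i $ j * (u $ j - x $ j))" if "i \<le> k" for i
    using that lt by (intro sum.cong) (auto simp: v_other)
  have k_notin: "k \<notin> set ks"
    using lt by blast
  \<comment> \<open>Only coordinates in \<open>ks\<close>, all below \<open>k\<close>, differ
    between \<open>u\<close> and \<open>x\<close>, so the other terms of row \<open>k\<close>
    vanish.\<close>
  have grad_k: "quad_grad H a u $ k = quad_grad H a x $ k
      + (\<Sum>j\<in>{j\<in>set ks. j < k}. H $ k $ j * (u $ j - x $ j))"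
  proof -
    have "quad_grad H a u $ k - quad_grad H a x $ k = (\<Sum>j\<in>UNIV. H $ k $ j * (u $ j - x $ j))"
      unfolding vector_minus_component[symmetric] quad_grad_diff
      by (simp add: matrix_vector_mult_def)
    also have "\<dots> = (\<Sum>j\<in>{j\<in>set ks. j < k}. H $ k $ j * (u $ j - x $ j))"
      using lt IH by (intro sum.mono_neutral_right) auto
    finally show ?thesis by simp
  qed
  have "v $ i = (if i \<in> set (ks @ [k])
    then min (r $ i) (max 0 (x $ i - quad_grad H a x $ i
           - (\<Sum>j\<in>{j\<in>set (ks @ [k]). j < i}. H $ i $ j * (v $ j - x $ j))))
    else x $ i)"
  proof (cases "i = k")
    case True
    have "v $ k = min (r $ k) (max 0 (u $ k - quad_grad H a u $ k))"
      by (simp add: v_def coord_step_def)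
    also have "u $ k = x $ k"
      using IH[of k] k_notin by simp
    finally show ?thesis
      unfolding True sum_eq[OF order_refl] grad_k by (simp add: algebra_simps)
  next
    case False
    then show ?thesis
      using IH[of i] lt[of i] sum_eq[of i] v_other[of i] by (cases "i \<in> set ks") auto
  qed
  then show ?case
    by (simp add: v_def u_def)
qed

lemma sweep_nth:
  fixes H :: "('n::{finite,linorder}) rmat" and a r x :: "'n rvec"
  defines "y \<equiv> sweep H a r x"
  shows "y $ i = min (r $ i) (max 0 ((x - quad_grad H a x - strict_lower H *v (y - x)) $ i))"
proof -
  have "(strict_lower H *v (y - x)) $ i = (\<Sum>j\<in>{j. j < i}. H $ i $ j * (y $ j - x $ j))"
    unfolding matrix_vector_mult_def strict_lower_def
    by (simp add: if_distrib[of "\<lambda>u. u * _"] sum.If_cases cong: if_cong)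
  then show ?thesis
    using fold_coord_step_nth[of "sorted_list_of_set UNIV" H a r x i]
    by (simp add: y_def sweep_def)
qed

section \<open>Stationarity and contraction of one sweep\<close>

context
  fixes H :: "('n::{finite,linorder}) rmat" and r :: "'n rvec"
  assumes sym: "transpose H = H"
    and psd: "pos_semidef H"
    and diag: "\<And>i. H $ i $ i = 1"
    and r_pos: "\<And>i. 0 < r $ i"
begin

text \<open>The sweep projects \<open>u\<close> onto the box, and H = I + T +
  \<open>transpose T\<close> rewrites u - y as \<open>transpose T\<close> (y - x) - g(y), moving the
  gradient from \<open>x\<close> to \<open>y\<close>.\<close>

lemma sweep_perturbed_stationary:
  fixes a x :: "'n rvec"
  defines "y \<equiv> sweep H a r x"
  shows "perturbed_stationary r H a (transpose (strict_lower H) *v (y - x)) y"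
proof -
  let ?T = "strict_lower H"
  define u where "u = x - quad_grad H a x - ?T *v (y - x)"
  have y: "y $ i = min (r $ i) (max 0 (u $ i))" for i
    unfolding y_def u_def by (rule sweep_nth)
  have "H *v (y - x) = (y - x) + ?T *v (y - x) + transpose ?T *v (y - x)"
    by (subst unit_diagonal_splitting[OF sym diag])
      (simp add: matrix_vector_mult_add_rdistrib)
  then have u_y: "u - y = transpose ?T *v (y - x) - quad_grad H a y"
    unfolding u_def quad_grad_diff[of H a y x, unfolded diff_eq_eq]
    by (simp add: algebra_simps)
  \<comment> \<open>Coordinatewise: either y_i = u_i, or y_i is the endpoint violated by u_i and z_i
    lies on its other side.\<close>
  have "(u - y) \<bullet> (z - y) \<le> 0" if z: "z \<in> box_of r" for z
    unfolding inner_vec_def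
  proof (rule sum_nonpos)
    fix i
    have "0 \<le> z $ i" "z $ i \<le> r $ i"
      using z by (auto simp: mem_box_of)
    then show "(u - y) $ i \<bullet> (z - y) $ i \<le> 0"
      using r_pos[of i] by (auto simp: y min_def max_def mult_le_0_iff)
  qed
  then have "(transpose ?T *v (y - x)) \<bullet> (z - y) \<le> quad_grad H a y \<bullet> (z - y)"
    if "z \<in> box_of r" for z
    using that unfolding u_y by (simp add: inner_diff_left)
  moreover have "y \<in> box_of r"
    using r_pos by (auto simp: mem_box_of y less_imp_le)
  ultimately show ?thesis
    unfolding perturbed_stationary_def by blast
qed

text \<open>With d = y - x, expansion at \<open>y\<close> bounds the decrease below by -d . (T d)
  plus half of d . (H d) = |d|^2 + 2 d . (T d); the \<open>T\<close> terms cancel.\<close>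

lemma sweep_sufficient_decrease:
  assumes x: "x \<in> box_of r"
  shows "(norm (sweep H a r x - x))\<^sup>2 / 2 \<le> gap H a r x - gap H a r (sweep H a r x)"
proof -
  define y where "y = sweep H a r x"
  let ?T = "strict_lower H" and ?d = "y - x"
  have "(transpose ?T *v ?d) \<bullet> (x - y) \<le> quad_grad H a y \<bullet> (x - y)"
    using sweep_perturbed_stationary[of a x] x
    unfolding y_def perturbed_stationary_def by blast
  moreover have "(transpose ?T *v ?d) \<bullet> (x - y) = - (?d \<bullet> (?T *v ?d))"
    unfolding inner_matrix_vector_mult[of "?d"] by (simp flip: inner_minus_right)
  moreover have "(x - y) \<bullet> (H *v (x - y)) = (norm ?d)\<^sup>2 + 2 * (?d \<bullet> (?T *v ?d))"
  proof -
    have "(x - y) \<bullet> (H *v (x - y)) = ?d \<bullet> (H *v ?d)"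
      by (simp add: matrix_vector_mult_diff_distrib inner_diff_left inner_diff_right)
    also have "\<dots> = ?d \<bullet> (?d + ?T *v ?d + transpose ?T *v ?d)"
      by (subst (1) unit_diagonal_splitting[OF sym diag])
        (simp add: matrix_vector_mult_add_rdistrib)
    also have "?d \<bullet> (transpose ?T *v ?d) = ?d \<bullet> (?T *v ?d)"
      unfolding inner_matrix_vector_mult[of ?d "transpose ?T"] by (simp add: inner_commute)
    ultimately show ?thesis
      by (simp add: inner_add_right power2_norm_eq_inner)
  qed
  ultimately show ?thesis
    using quad_obj_expand[OF sym, of a x y] unfolding gap_def y_def[symmetric] by linarith
qed

lemma gap_sweep_le:
  assumes bound: "residual_error_bound H a r \<kappa>" and x: "x \<in> box_of r"
  shows "gap H a r (sweep H a r x) \<le> sweep_bound H \<kappa> * gap H a r x"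
proof -
  define y where "y = sweep H a r x"
  let ?T = "strict_lower H" and ?D = "infdist y (opt_set H a r)"
  let ?q = "transpose ?T *v (y - x)"
  define K where "K = \<kappa> * (spectral_norm ?T)\<^sup>2"
  have \<kappa>: "0 < \<kappa>"
    using bound by (simp add: residual_error_bound_def)
  then have K: "0 \<le> K"
    by (simp add: K_def)
  have stat: "perturbed_stationary r H a ?q y"
    unfolding y_def by (rule sweep_perturbed_stationary)
  have "?D \<le> \<kappa> * norm (residual H a r y)"
    using bound stat unfolding residual_error_bound_def perturbed_stationary_def by blast
  also have "\<dots> \<le> \<kappa> * norm ?q"
    using perturbed_stationary_norm_residual_le[OF r_pos stat] \<kappa> by simp
  finally have D: "?D \<le> \<kappa> * norm ?q" .
  have "gap H a r y \<le> norm ?q * ?D - lambda_min H / 2 * ?D\<^sup>2"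
    by (rule perturbed_stationary_gap_le[OF r_pos sym stat])
  \<comment> \<open>Positive semidefiniteness allows the curvature term to be dropped.\<close>
  also have "\<dots> \<le> norm ?q * ?D"
    using lambda_min_nonneg[OF sym psd] by simp
  also have "\<dots> \<le> norm ?q * (\<kappa> * norm ?q)"
    by (intro mult_left_mono D norm_ge_zero)
  also have "\<dots> = \<kappa> * (norm ?q)\<^sup>2"
    by (simp add: power2_eq_square)
  also have "\<dots> \<le> \<kappa> * (spectral_norm ?T * norm (y - x))\<^sup>2"
    using \<kappa> by (intro mult_left_mono power_mono norm_transpose_mult_le_spectral_norm) auto
  also have "\<dots> = 2 * K * ((norm (y - x))\<^sup>2 / 2)"
    by (simp add: K_def power_mult_distrib)
  also have "\<dots> \<le> 2 * K * (gap H a r x - gap H a r y)"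
    using sweep_sufficient_decrease[OF x, of a] K by (intro mult_left_mono) (auto simp: y_def)
  \<comment> \<open>The gap at \<open>y\<close> occurs on both sides; absorbing it on the left gives
    the denominator 1 + 2K of \<open>sweep_bound\<close>.\<close>
  finally have "gap H a r y * (1 + 2 * K) \<le> 2 * K * gap H a r x"
    by (simp add: algebra_simps)
  then have "gap H a r y \<le> 2 * K / (1 + 2 * K) * gap H a r x"
    using K by (simp add: pos_le_divide_eq add_pos_nonneg)
  then show ?thesis
    by (simp add: y_def sweep_bound_def K_def mult.assoc)
qed

lemma chi_star_le_sweep_bound:
  assumes "residual_error_bound H a r \<kappa>"
  shows "chi_star H a r \<le> sweep_bound H \<kappa>"
  unfolding chi_star_def
proof (rule cSUP_least[OF box_not_subset_opt_set[OF r_pos diag]])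
  fix x assume x: "x \<in> box_of r - opt_set H a r"
  then show "gap H a r (sweep H a r x) / gap H a r x \<le> sweep_bound H \<kappa>"
    using gap_sweep_le[OF assms, of x] gap_pos[OF r_pos x] by (simp add: divide_le_eq)
qed

end

theorem proposition3:
  fixes H :: "('n::{finite,linorder}) rmat" and a r :: "'n rvec"
  assumes "transpose H = H"
    and "pos_semidef H"
    and "\<And>i. H $ i $ i = 1"
    and "\<And>i. 0 < r $ i"
  shows "(\<forall>\<kappa>. residual_error_bound H a r \<kappa> \<longrightarrow> chi_star H a r \<le> sweep_bound H \<kappa>) \<and>
    (\<forall>\<nu>. quadratic_growth H a r \<nu> \<longrightarrow>
       residual_error_bound H a r (kappa_growth H \<nu>) \<and>
       chi_star H a r \<le> sweep_bound H (kappa_growth H \<nu>))"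
  using chi_star_le_sweep_bound[OF assms] residual_error_bound_kappa_growth[OF assms(4,1,2)]
  by blast

end
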